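(* Let $G$ be a group, let $\mathcal{H}$ be a complex Hilbert space, and let $N:G\to\mathcal{B}(\mathcal{H})$ be a positive definite function such that $\{N(s):s\in G\}$ is a family of commuting normal operators. Then for every $k\in\mathbb{N}$ the map $N_k:G\to\mathcal{B}(\mathcal{H})$, $N_k(s)=N(s)^k$, is a positive definite function.
   Context: $\mathcal{B}(\mathcal{H})$ is the algebra of bounded linear operators on $\mathcal{H}$. A map $T:G\to\mathcal{B}(\mathcal{H})$ is positive definite if $T(s^{-1})=T(s)^*$ for every $s\in G$ and $\sum_{s\in G}\sum_{t\in G}\langle T(t^{-1}s)h(s),h(t)\rangle\ge 0$ for every finitely supported function $h:G\to\mathcal{H}$. *)

theory Defs
  imports "HOL-Analysis.Analysis" "HOL-Algebra.Group"
begin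

text \<open>
  A complex inner product space is given together with its underlying real inner product
  space: the real scalar multiplication is the restriction of \<open>scaleC\<close>, and the real inner
  product is the real part of \<open>cinner\<close>. Hence \<open>cinner x x\<close> is the square of the norm, and
  its positivity and definiteness come from \<^class>\<open>real_inner\<close>. The complex inner product is
  linear in the first argument.
\<close>

class complex_inner = real_inner +
  fixes scaleC :: "complex \<Rightarrow> 'a \<Rightarrow> 'a"  (infixr \<open>*\<^sub>C\<close> 75)
    and cinner :: "'a \<Rightarrow> 'a \<Rightarrow> complex"
  assumes scaleC_add_right: "a *\<^sub>C (x + y) = a *\<^sub>C x + a *\<^sub>C y"
    and scaleC_add_left: "(a + b) *\<^sub>C x = a *\<^sub>C x + b *\<^sub>C x"
    and scaleC_scaleC: "a *\<^sub>C (b *\<^sub>C x) = (a * b) *\<^sub>C x"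
    and scaleC_of_real: "complex_of_real r *\<^sub>C x = r *\<^sub>R x"
    and cinner_commute: "cinner x y = cnj (cinner y x)"
    and cinner_add_left: "cinner (x + y) z = cinner x z + cinner y z"
    and cinner_scaleC_left: "cinner (a *\<^sub>C x) y = a * cinner x y"
    and inner_eq_Re_cinner: "inner x y = Re (cinner x y)"

class complex_hilbert_space = complex_inner + complete_space

lemma cinner_self: "cinner x x = complex_of_real ((norm x)\<^sup>2)"
  for x :: "'a::complex_inner"
proof (rule complex_eqI)
  show "Re (cinner x x) = Re (complex_of_real ((norm x)\<^sup>2))"
    by (simp add: power2_norm_eq_inner inner_eq_Re_cinner)
  have "Im (cinner x x) = - Im (cinner x x)"
    using arg_cong[OF cinner_commute[of x x], of Im] by simp
  then show "Im (cinner x x) = Im (complex_of_real ((norm x)\<^sup>2))"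
    by simp
qed

instantiation complex :: complex_hilbert_space
begin

definition scaleC_complex :: "complex \<Rightarrow> complex \<Rightarrow> complex"
  where "scaleC_complex a x = a * x"

definition cinner_complex :: "complex \<Rightarrow> complex \<Rightarrow> complex"
  where "cinner_complex x y = x * cnj y"

instance
  by standard
    (auto simp: scaleC_complex_def cinner_complex_def inner_complex_def algebra_simps
      scaleR_conv_of_real)

end

text \<open>
  The algebra of bounded operators on a complex Hilbert space consists of the functions
  satisfying \<open>bounded_clinear\<close>, with composition as product.
\<close>

definition bounded_clinear :: "('h::complex_inner \<Rightarrow> 'h) \<Rightarrow> bool"
  where "bounded_clinear A \<longleftrightarrow>
    bounded_linear A \<and> (\<forall>c x. A (c *\<^sub>C x) = c *\<^sub>C A x)"

text \<open>
  For a bounded operator on a complex Hilbert space the description below is proper: existence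
  is the Riesz representation theorem, uniqueness is definiteness of the inner product.
\<close>

definition cadjoint :: "('h::complex_hilbert_space \<Rightarrow> 'h) \<Rightarrow> 'h \<Rightarrow> 'h"
  where "cadjoint A =
    (THE B. bounded_clinear B \<and> (\<forall>x y. cinner (A x) y = cinner x (B y)))"

definition normal_operator :: "('h::complex_hilbert_space \<Rightarrow> 'h) \<Rightarrow> bool"
  where "normal_operator A \<longleftrightarrow> bounded_clinear A \<and> A \<circ> cadjoint A = cadjoint A \<circ> A"

text \<open>
  In the last clause the summands with \<open>h s = 0\<close> or \<open>h t = 0\<close> vanish, so the double sum over
  the group is the double sum over the support of \<open>h\<close>. Membership in the nonnegative reals
  includes the assertion that the sum is real.
\<close>

definition positive_definite ::
    "('g, 'b) monoid_scheme \<Rightarrow> ('g \<Rightarrow> 'h::complex_hilbert_space \<Rightarrow> 'h) \<Rightarrow> bool"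
  where "positive_definite G T \<longleftrightarrow>
    (\<forall>s\<in>carrier G. bounded_clinear (T s)) \<and>
    (\<forall>s\<in>carrier G. T (inv\<^bsub>G\<^esub> s) = cadjoint (T s)) \<and>
    (\<forall>h :: 'g \<Rightarrow> 'h. finite {s \<in> carrier G. h s \<noteq> 0} \<longrightarrow>
      (\<Sum>s\<in>{s \<in> carrier G. h s \<noteq> 0}. \<Sum>t\<in>{t \<in> carrier G. h t \<noteq> 0}.
        cinner (T (inv\<^bsub>G\<^esub> t \<otimes>\<^bsub>G\<^esub> s) (h s)) (h t)) \<in> \<real>\<^sub>\<ge>\<^sub>0)"

end

theory Submission imports Defs begin

text \<open>
  Induction on the exponent reduces the theorem to a Schur product statement: if \<open>A\<close> and \<open>B\<close> are
  positive operator matrices and the entries of \<open>A\<close> commute with those of \<open>B\<close>, then the entrywise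
  product \<open>(A i j B i j)\<close> is positive. After rescaling, \<open>0 \<le> A \<le> 1\<close>. Following Riesz, put
  \<open>M 0 = A\<close> and \<open>M (n+1) = M n - (M n)\<^sup>2\<close>; then \<open>0 \<le> M n \<le> 1\<close> for all \<open>n\<close> and \<open>A\<close> is the strong sum
  of the squares \<open>(M n)\<^sup>2\<close>. In the Schur product of \<open>(M n)\<^sup>2\<close> with \<open>B\<close>, one factor \<open>M n\<close> moves past \<open>B\<close>
  and the other moves to the right side of the inner product, which exhibits the form as a sum of
  values of the positive form of \<open>B\<close>. Neither the spectral theorem nor square roots are needed.
\<close>

section \<open>Schur products of operator matrices\<close>

text \<open>Only the real inner product is used. For the complex form of a kernel, reality is
  obtained separately from the adjoint relation, so the real part is all that has to be estimated
  here.\<close>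

definition opmat_form ::
    "'i set \<Rightarrow> ('i \<Rightarrow> 'i \<Rightarrow> 'a \<Rightarrow> 'a::real_inner) \<Rightarrow> ('i \<Rightarrow> 'a) \<Rightarrow> ('i \<Rightarrow> 'a) \<Rightarrow> real"
  where "opmat_form S M x y = (\<Sum>i\<in>S. \<Sum>j\<in>S. M i j (x j) \<bullet> y i)"

definition opmat_apply ::
    "'i set \<Rightarrow> ('i \<Rightarrow> 'i \<Rightarrow> 'a \<Rightarrow> 'a::real_inner) \<Rightarrow> ('i \<Rightarrow> 'a) \<Rightarrow> 'i \<Rightarrow> 'a"
  where "opmat_apply S M x = (\<lambda>i. \<Sum>j\<in>S. M i j (x j))"

text \<open>Self-adjointness of the whole matrix on the direct sum of copies of the space; a single
  entry is in general not self-adjoint.\<close>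

definition opmat_symmetric :: "'i set \<Rightarrow> ('i \<Rightarrow> 'i \<Rightarrow> 'a \<Rightarrow> 'a::real_inner) \<Rightarrow> bool"
  where "opmat_symmetric S M \<longleftrightarrow>
    (\<forall>i\<in>S. \<forall>j\<in>S. linear (M i j) \<and> (\<forall>v w. M i j v \<bullet> w = v \<bullet> M j i w))"

definition opmat_residual ::
    "'i set \<Rightarrow> ('i \<Rightarrow> 'i \<Rightarrow> 'a \<Rightarrow> 'a::real_inner) \<Rightarrow> 'i \<Rightarrow> 'i \<Rightarrow> 'a \<Rightarrow> 'a"
  where "opmat_residual S M = (\<lambda>i j v. M i j v - (\<Sum>k\<in>S. M i k (M k j v)))"

lemma opmat_symmetric_linear:
  "opmat_symmetric S M \<Longrightarrow> i \<in> S \<Longrightarrow> j \<in> S \<Longrightarrow> linear (M i j)"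
  by (simp add: opmat_symmetric_def)

lemma opmat_symmetric_adjoint:
  "opmat_symmetric S M \<Longrightarrow> i \<in> S \<Longrightarrow> j \<in> S \<Longrightarrow> M i j v \<bullet> w = v \<bullet> M j i w"
  by (simp add: opmat_symmetric_def)

lemma opmat_form_eq_apply:
  "opmat_form S M x y = (\<Sum>i\<in>S. opmat_apply S M x i \<bullet> y i)"
  by (simp add: opmat_form_def opmat_apply_def inner_sum_left)

lemma opmat_form_commute:
  assumes "opmat_symmetric S M"
  shows "opmat_form S M x y = opmat_form S M y x"
proof -
  have "opmat_form S M x y = (\<Sum>i\<in>S. \<Sum>j\<in>S. M j i (y i) \<bullet> x j)"
    unfolding opmat_form_def
    by (intro sum.cong refl) (metis assms opmat_symmetric_adjoint inner_commute)
  also have "\<dots> = opmat_form S M y x"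
    unfolding opmat_form_def by (rule sum.swap)
  finally show ?thesis .
qed

lemma opmat_form_diff_left:
  assumes "opmat_symmetric S M"
  shows "opmat_form S M (\<lambda>i. x i - y i) z = opmat_form S M x z - opmat_form S M y z"
  by (simp add: opmat_form_def linear_diff[OF opmat_symmetric_linear[OF assms]]
      inner_diff_left sum_subtractf cong: sum.cong)

lemma opmat_form_diff_right:
  "opmat_form S M z (\<lambda>i. x i - y i) = opmat_form S M z x - opmat_form S M z y"
  by (simp add: opmat_form_def inner_diff_right sum_subtractf)

section \<open>The residual M - M^2 of a symmetric operator matrix\<close>

lemma opmat_form_residual:
  assumes "opmat_symmetric S M"
  shows "opmat_form S (opmat_residual S M) x x =
    opmat_form S M x x - (\<Sum>i\<in>S. opmat_apply S M x i \<bullet> opmat_apply S M x i)"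
proof -
  \<comment> \<open>Symmetry moves the left factor of M^2 to the other side, so the form of M^2 at
    \<open>x\<close> is the squared norm of M x.\<close>
  have "(\<Sum>i\<in>S. \<Sum>j\<in>S. (\<Sum>k\<in>S. M i k (M k j (x j))) \<bullet> x i) =
      (\<Sum>i\<in>S. \<Sum>j\<in>S. \<Sum>k\<in>S. M k j (x j) \<bullet> M k i (x i))"
    by (intro sum.cong refl)
      (simp add: inner_sum_left opmat_symmetric_adjoint[OF assms, where v="M _ _ _"] cong: sum.cong)
  also have "\<dots> = (\<Sum>i\<in>S. \<Sum>k\<in>S. \<Sum>j\<in>S. M k j (x j) \<bullet> M k i (x i))"
    by (intro sum.cong refl sum.swap)
  also have "\<dots> = (\<Sum>k\<in>S. \<Sum>i\<in>S. \<Sum>j\<in>S. M k j (x j) \<bullet> M k i (x i))"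
    by (rule sum.swap)
  also have "\<dots> = (\<Sum>k\<in>S. opmat_apply S M x k \<bullet> opmat_apply S M x k)"
    by (simp add: opmat_apply_def inner_sum_left inner_sum_right)
  finally show ?thesis
    by (simp add: opmat_form_def opmat_residual_def inner_diff_left sum_subtractf)
qed

lemma opmat_symmetric_residual:
  assumes "opmat_symmetric S M"
  shows "opmat_symmetric S (opmat_residual S M)"
  unfolding opmat_symmetric_def
proof (intro ballI conjI allI)
  fix i j assume ij: "i \<in> S" "j \<in> S"
  have "linear (\<lambda>v. M i k (M k j v))" if "k \<in> S" for k
    using linear_compose[of "M k j" "M i k"] that ij assms
    by (simp add: o_def opmat_symmetric_linear)
  then show "linear (opmat_residual S M i j)"
    unfolding opmat_residual_def using ij assms
    by (intro linear_compose_sub linear_compose_sum opmat_symmetric_linear) auto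
  fix v w
  have "M i k (M k j v) \<bullet> w = v \<bullet> M j k (M k i w)" if "k \<in> S" for k
    using that ij by (simp add: opmat_symmetric_adjoint[OF assms])
  then show "opmat_residual S M i j v \<bullet> w = v \<bullet> opmat_residual S M j i w"
    using ij
    by (simp add: opmat_residual_def inner_diff_left inner_diff_right inner_sum_left
        inner_sum_right opmat_symmetric_adjoint[OF assms, of i j v w])
qed

text \<open>Rests on the identity M - M^2 = (1 - M) M (1 - M) + M (1 - M) M: with u = M x, the first
  summand gives the form of M at x - u, the second that of 1 - M at u.\<close>

lemma opmat_form_residual_nonneg:
  assumes sym: "opmat_symmetric S M"
    and nonneg: "\<And>x. 0 \<le> opmat_form S M x x"
    and le: "\<And>x. opmat_form S M x x \<le> (\<Sum>i\<in>S. x i \<bullet> x i)"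
  shows "0 \<le> opmat_form S (opmat_residual S M) x x"
proof -
  define u where "u = opmat_apply S M x"
  have "opmat_form S M x u = (\<Sum>i\<in>S. u i \<bullet> u i)"
    by (simp add: opmat_form_eq_apply u_def)
  moreover have "opmat_form S M (\<lambda>i. x i - u i) (\<lambda>i. x i - u i) =
      opmat_form S M x x - 2 * opmat_form S M x u + opmat_form S M u u"
    by (simp add: opmat_form_diff_left[OF sym] opmat_form_diff_right
        opmat_form_commute[OF sym, of u x])
  ultimately have "opmat_form S (opmat_residual S M) x x =
      opmat_form S M (\<lambda>i. x i - u i) (\<lambda>i. x i - u i)
        + ((\<Sum>i\<in>S. u i \<bullet> u i) - opmat_form S M u u)"
    by (simp add: opmat_form_residual[OF sym] u_def)
  then show ?thesis
    using nonneg[of "\<lambda>i. x i - u i"] le[of u] by simp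
qed

text \<open>The difference of the two sides is the Schur form of M^2 with \<open>B\<close>. For each
  fixed inner index \<open>k\<close> of the matrix product it contributes the form of
  \<open>B\<close> at the vector with components \<open>M k j (x j)\<close>.\<close>

lemma opmat_schur_residual_le:
  assumes sym: "opmat_symmetric S M"
    and B: "\<And>x. 0 \<le> opmat_form S B x x"
    and comm: "\<And>i j k l v. i \<in> S \<Longrightarrow> j \<in> S \<Longrightarrow> k \<in> S \<Longrightarrow> l \<in> S \<Longrightarrow>
      M i j (B k l v) = B k l (M i j v)"
  shows "opmat_form S (\<lambda>i j v. opmat_residual S M i j (B i j v)) x x
    \<le> opmat_form S (\<lambda>i j v. M i j (B i j v)) x x"
proof -
  have "M i k (M k j (B i j v)) \<bullet> w = B i j (M k j v) \<bullet> M k i w"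
    if "i \<in> S" "j \<in> S" "k \<in> S" for i j k v w
    using that comm[of k j i j v] opmat_symmetric_adjoint[OF sym, of i k "B i j (M k j v)" w]
    by simp
  then have "(\<Sum>i\<in>S. \<Sum>j\<in>S. (\<Sum>k\<in>S. M i k (M k j (B i j (x j)))) \<bullet> x i) =
      (\<Sum>i\<in>S. \<Sum>j\<in>S. \<Sum>k\<in>S. B i j (M k j (x j)) \<bullet> M k i (x i))"
    by (simp add: inner_sum_left)
  also have "\<dots> = (\<Sum>i\<in>S. \<Sum>k\<in>S. \<Sum>j\<in>S. B i j (M k j (x j)) \<bullet> M k i (x i))"
    by (intro sum.cong refl sum.swap)
  also have "\<dots> = (\<Sum>k\<in>S. \<Sum>i\<in>S. \<Sum>j\<in>S. B i j (M k j (x j)) \<bullet> M k i (x i))"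
    by (rule sum.swap)
  also have "\<dots> \<ge> 0"
    by (intro sum_nonneg B[unfolded opmat_form_def])
  finally show ?thesis
    by (simp add: opmat_form_def opmat_residual_def inner_diff_left sum_subtractf)
qed

text \<open>Along the iteration the Schur forms of \<open>M n\<close> with \<open>B\<close> decrease
  and tend to 0, so the initial one is nonnegative.\<close>

lemma opmat_schur_nonneg_of_le_one:
  assumes fin: "finite S"
    and sym: "opmat_symmetric S A"
    and nonneg: "\<And>x. 0 \<le> opmat_form S A x x"
    and le: "\<And>x. opmat_form S A x x \<le> (\<Sum>i\<in>S. x i \<bullet> x i)"
    and B: "\<And>x. 0 \<le> opmat_form S B x x"
    and B0: "\<And>i j. i \<in> S \<Longrightarrow> j \<in> S \<Longrightarrow> linear (B i j)"
    and comm: "\<And>i j k l v. i \<in> S \<Longrightarrow> j \<in> S \<Longrightarrow> k \<in> S \<Longrightarrow> l \<in> S \<Longrightarrow>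
      A i j (B k l v) = B k l (A i j v)"
  shows "0 \<le> opmat_form S (\<lambda>i j v. A i j (B i j v)) x x"
proof -
  define M where "M = (\<lambda>n. (opmat_residual S ^^ n) A)"
  have M_0: "M 0 = A" and M_Suc: "M (Suc n) = opmat_residual S (M n)" for n
    by (simp_all add: M_def)
  have M: "opmat_symmetric S (M n) \<and> (\<forall>x. 0 \<le> opmat_form S (M n) x x) \<and>
      (\<forall>x. opmat_form S (M n) x x \<le> (\<Sum>i\<in>S. x i \<bullet> x i)) \<and>
      (\<forall>i\<in>S. \<forall>j\<in>S. \<forall>k\<in>S. \<forall>l\<in>S. \<forall>v. M n i j (B k l v) = B k l (M n i j v))" for n
  proof (induction n)
    case 0
    show ?case using assms by (simp add: M_0)
  next
    case (Suc n)
    have "opmat_form S (M (Suc n)) x x \<le> opmat_form S (M n) x x" for x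
      using Suc by (simp add: M_Suc opmat_form_residual sum_nonneg)
    then have "opmat_form S (M (Suc n)) x x \<le> (\<Sum>i\<in>S. x i \<bullet> x i)" for x
      using Suc order_trans by blast
    \<comment> \<open>Commutation is carried through the induction because the comparison of Schur
      forms is applied at every stage; linearity of \<open>B k l\<close> takes it past the
      difference and the sum in the residual.\<close>
    moreover have "M (Suc n) i j (B k l v) = B k l (M (Suc n) i j v)"
      if "i \<in> S" "j \<in> S" "k \<in> S" "l \<in> S" for i j k l v
      using Suc that B0[of k l]
      by (simp add: M_Suc opmat_residual_def linear_diff linear_sum cong: sum.cong)
    ultimately show ?case
      using Suc opmat_symmetric_residual[of S "M n"] opmat_form_residual_nonneg[of S "M n"]
      by (simp add: M_Suc)
  qed
  have apply_tendsto: "(\<lambda>n. opmat_apply S (M n) y i) \<longlonglongrightarrow> 0" if "i \<in> S" for y i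
  proof -
    \<comment> \<open>The values \<open>q n\<close> decrease and are bounded below, so their
      successive differences tend to 0. These differences are the squared norms of
      \<open>M n\<close> applied to \<open>y\<close>, which dominate each component.\<close>
    define q where "q = (\<lambda>n. opmat_form S (M n) y y)"
    have q_Suc: "q n - q (Suc n) =
        (\<Sum>i\<in>S. opmat_apply S (M n) y i \<bullet> opmat_apply S (M n) y i)" for n
      using M by (simp add: q_def M_Suc opmat_form_residual)
    have "0 \<le> q n - q (Suc n)" for n
      unfolding q_Suc by (intro sum_nonneg inner_ge_zero)
    then have "decseq q"
      by (intro decseq_SucI) simp
    moreover have "0 \<le> q n" for n
      using M by (simp add: q_def)
    ultimately obtain L where L: "q \<longlonglongrightarrow> L"
      using decseq_convergent by blast
    have "(\<lambda>n. q n - q (Suc n)) \<longlonglongrightarrow> L - L"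
      by (intro tendsto_diff L LIMSEQ_Suc)
    then have lim: "(\<lambda>n. q n - q (Suc n)) \<longlonglongrightarrow> 0"
      by simp
    have "(\<lambda>n. (norm (opmat_apply S (M n) y i))\<^sup>2) \<longlonglongrightarrow> 0"
    proof (rule tendsto_sandwich[OF _ _ tendsto_const lim])
      show "\<forall>\<^sub>F n in sequentially. (norm (opmat_apply S (M n) y i))\<^sup>2 \<le> q n - q (Suc n)"
        unfolding q_Suc power2_norm_eq_inner using fin that
        by (intro always_eventually allI member_le_sum) auto
    qed simp
    then show ?thesis
      by (simp add: tendsto_norm_zero_iff)
  qed
  have entry_tendsto: "(\<lambda>n. M n i j v) \<longlonglongrightarrow> 0" if ij: "i \<in> S" "j \<in> S" for i j v
  proof -
    \<comment> \<open>A vector concentrated at \<open>j\<close> isolates a single entry of the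
      matrix.\<close>
    have "opmat_apply S (M n) (\<lambda>k. if k = j then v else 0) i = M n i j v" for n
    proof -
      have "opmat_apply S (M n) (\<lambda>k. if k = j then v else 0) i =
          (\<Sum>k\<in>S. if k = j then M n i k v else 0)"
        unfolding opmat_apply_def
        by (intro sum.cong refl)
          (use M ij linear_0[OF opmat_symmetric_linear[of S "M n" i]] in auto)
      then show ?thesis
        using fin ij by simp
    qed
    then show ?thesis
      using apply_tendsto[of i "\<lambda>k. if k = j then v else 0"] ij by simp
  qed
  define F where "F = (\<lambda>n. opmat_form S (\<lambda>i j v. M n i j (B i j v)) x x)"
  \<comment> \<open>The vectors \<open>B i j (x j)\<close> do not depend on \<open>n\<close>, so
    pointwise convergence of the entries suffices.\<close>
  have "F \<longlonglongrightarrow> (\<Sum>i\<in>S. \<Sum>j\<in>S. 0 \<bullet> x i)"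
    unfolding F_def opmat_form_def
    by (intro tendsto_sum tendsto_inner entry_tendsto tendsto_const)
  then have "F \<longlonglongrightarrow> 0"
    by simp
  moreover have "decseq F"
    unfolding F_def
    using M B by (intro decseq_SucI, unfold M_Suc, intro opmat_schur_residual_le) blast+
  ultimately have "0 \<le> F 0"
    by (metis decseq_ge)
  then show ?thesis
    by (simp add: F_def M_0)
qed

section \<open>Boundedness and rescaling\<close>

lemma opmat_form_bounded:
  assumes "finite S" and "\<And>i j. i \<in> S \<Longrightarrow> j \<in> S \<Longrightarrow> bounded_linear (A i j)"
  obtains c where "c > 0" and "\<And>x. opmat_form S A x x \<le> c * (\<Sum>i\<in>S. x i \<bullet> x i)"
proof
  \<comment> \<open>The summand 1 keeps \<open>c\<close> positive even if all entries vanish or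
    \<open>S\<close> is empty, so that division by \<open>c\<close> is possible.\<close>
  define c where "c = 1 + (\<Sum>i\<in>S. \<Sum>j\<in>S. onorm (A i j))"
  have pos: "0 \<le> (\<Sum>i\<in>S. \<Sum>j\<in>S. onorm (A i j))"
    by (intro sum_nonneg onorm_pos_le assms)
  then show "c > 0"
    by (simp add: c_def)
  fix x :: "'a \<Rightarrow> 'b"
  define n where "n = (\<Sum>i\<in>S. x i \<bullet> x i)"
  have norm_le: "norm (x i) \<le> sqrt n" if "i \<in> S" for i
    unfolding n_def norm_eq_sqrt_inner using that assms(1)
    by (intro real_sqrt_le_mono member_le_sum) auto
  have n0: "0 \<le> n"
    by (simp add: n_def sum_nonneg)
  have "A i j (x j) \<bullet> x i \<le> onorm (A i j) * n" if ij: "i \<in> S" "j \<in> S" for i j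
  proof -
    have "A i j (x j) \<bullet> x i \<le> norm (A i j (x j)) * norm (x i)"
      by (rule norm_cauchy_schwarz)
    also have "\<dots> \<le> (onorm (A i j) * norm (x j)) * norm (x i)"
      by (intro mult_right_mono onorm assms ij) auto
    also have "\<dots> \<le> onorm (A i j) * (sqrt n * sqrt n)"
      unfolding mult.assoc using ij
      by (intro mult_left_mono mult_mono norm_le onorm_pos_le assms) (auto simp: n0)
    finally show ?thesis
      using n0 by simp
  qed
  then have "opmat_form S A x x \<le> (\<Sum>i\<in>S. \<Sum>j\<in>S. onorm (A i j)) * n"
    unfolding opmat_form_def sum_distrib_right by (intro sum_mono)
  also have "\<dots> \<le> c * n"
    using n0 by (intro mult_right_mono) (auto simp: c_def)
  finally show "opmat_form S A x x \<le> c * (\<Sum>i\<in>S. x i \<bullet> x i)"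
    by (simp add: n_def)
qed

theorem opmat_schur_nonneg:
  assumes fin: "finite S"
    and bl: "\<And>i j. i \<in> S \<Longrightarrow> j \<in> S \<Longrightarrow> bounded_linear (A i j)"
    and adj: "\<And>i j v w. i \<in> S \<Longrightarrow> j \<in> S \<Longrightarrow> A i j v \<bullet> w = v \<bullet> A j i w"
    and nonneg: "\<And>x. 0 \<le> opmat_form S A x x"
    and B: "\<And>x. 0 \<le> opmat_form S B x x"
    and B0: "\<And>i j. i \<in> S \<Longrightarrow> j \<in> S \<Longrightarrow> linear (B i j)"
    and comm: "\<And>i j k l v. i \<in> S \<Longrightarrow> j \<in> S \<Longrightarrow> k \<in> S \<Longrightarrow> l \<in> S \<Longrightarrow>
      A i j (B k l v) = B k l (A i j v)"
  shows "0 \<le> opmat_form S (\<lambda>i j v. A i j (B i j v)) x x"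
proof -
  obtain c where c: "c > 0" "\<And>x. opmat_form S A x x \<le> c * (\<Sum>i\<in>S. x i \<bullet> x i)"
    using opmat_form_bounded[of S A] fin bl by blast
  \<comment> \<open>Division by \<open>c\<close> puts the form of \<open>A\<close> below that of the
    identity. The Schur form is multiplied by the same positive factor, so its sign is
    preserved.\<close>
  define A' where "A' = (\<lambda>i j v. inverse c *\<^sub>R A i j v)"
  have form: "opmat_form S A' y y = inverse c * opmat_form S A y y" for y
    by (simp add: opmat_form_def A'_def sum_distrib_left)
  have "0 \<le> opmat_form S (\<lambda>i j v. A' i j (B i j v)) x x"
  proof (rule opmat_schur_nonneg_of_le_one[OF fin _ _ _ B B0])
    show "opmat_symmetric S A'"
      using adj bl[THEN bounded_linear.linear]
      by (auto simp: opmat_symmetric_def A'_def intro!: linear_compose_scale_right)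
    show "0 \<le> opmat_form S A' y y" for y
      using nonneg[of y] c(1) by (simp add: form)
    show "opmat_form S A' y y \<le> (\<Sum>i\<in>S. y i \<bullet> y i)" for y
      using c by (simp add: form field_simps)
    show "A' i j (B k l v) = B k l (A' i j v)" if "i \<in> S" "j \<in> S" "k \<in> S" "l \<in> S" for i j k l v
      using comm[OF that] B0[OF that(3,4)] by (simp add: A'_def linear_scale)
  qed
  also have "\<dots> = inverse c * opmat_form S (\<lambda>i j v. A i j (B i j v)) x x"
    by (simp add: opmat_form_def A'_def sum_distrib_left)
  finally show ?thesis
    using c(1) by (simp add: zero_le_mult_iff)
qed

section \<open>Complex inner product spaces\<close>

lemma cinner_add_right: "cinner x (y + z) = cinner x y + cinner x z"
  by (metis cinner_add_left cinner_commute complex_cnj_add)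

lemma cinner_scaleC_right: "cinner x (a *\<^sub>C y) = cnj a * cinner x y"
  by (metis cinner_commute cinner_scaleC_left complex_cnj_mult)

lemma cinner_zero_left [simp]: "cinner 0 x = 0"
  using cinner_add_left[of 0 0 x] by simp

lemma cinner_zero_right [simp]: "cinner x 0 = 0"
  using cinner_add_right[of x 0 0] by simp

lemma bounded_clinear_bounded_linear: "bounded_clinear A \<Longrightarrow> bounded_linear A"
  by (simp add: bounded_clinear_def)

lemma bounded_clinear_funpow:
  assumes "bounded_clinear A"
  shows "bounded_clinear (A ^^ k)"
proof (induction k)
  case 0
  show ?case
    using bounded_linear_ident by (simp add: bounded_clinear_def id_def)
next
  case (Suc k)
  then show ?case
    using assms bounded_linear_compose[of A "A ^^ k"]
    by (simp add: bounded_clinear_def o_def)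
qed

lemma funpow_adjoint:
  fixes A B :: "'a::complex_inner \<Rightarrow> 'a"
  assumes "\<And>x y. cinner (A x) y = cinner x (B y)"
  shows "cinner ((A ^^ k) x) y = cinner x ((B ^^ k) y)"
proof (induction k arbitrary: x y)
  case (Suc k)
  have "cinner ((A ^^ Suc k) x) y = cinner ((A ^^ k) x) (B y)"
    by (simp add: assms)
  also have "\<dots> = cinner x ((B ^^ Suc k) y)"
    by (simp only: Suc.IH funpow_Suc_right o_apply)
  finally show ?case .
qed simp

text \<open>The given \<open>B\<close> settles existence in the description. Uniqueness follows from
  real parts alone, since the real inner product is definite.\<close>

lemma cadjoint_eqI:
  fixes A :: "'h::complex_hilbert_space \<Rightarrow> 'h"
  assumes "bounded_clinear B" and adj: "\<And>x y. cinner (A x) y = cinner x (B y)"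
  shows "cadjoint A = B"
  unfolding cadjoint_def
proof (rule the_equality)
  fix C assume C: "bounded_clinear C \<and> (\<forall>x y. cinner (A x) y = cinner x (C y))"
  show "C = B"
  proof
    fix y
    have "x \<bullet> C y = x \<bullet> B y" for x
      using C adj[of x y] by (simp add: inner_eq_Re_cinner)
    then show "C y = B y"
      using vector_eq_ldot[of "C y" "B y"] by simp
  qed
qed (use assms in auto)

section \<open>Positive definite functions\<close>

text \<open>Summing over a set \<open>S\<close> instead of the support of \<open>h\<close> allows
  \<open>S\<close> to stay fixed while \<open>h\<close> varies, as the matrix results
  require.\<close>

definition kernel_form ::
    "('g, 'b) monoid_scheme \<Rightarrow> ('g \<Rightarrow> 'h \<Rightarrow> 'h) \<Rightarrow> 'g set \<Rightarrow> ('g \<Rightarrow> 'h::complex_hilbert_space)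
      \<Rightarrow> complex"
  where "kernel_form G T S h =
    (\<Sum>s\<in>S. \<Sum>t\<in>S. cinner (T (inv\<^bsub>G\<^esub> t \<otimes>\<^bsub>G\<^esub> s) (h s)) (h t))"

lemma Re_kernel_form:
  "Re (kernel_form G T S h) = opmat_form S (\<lambda>t s. T (inv\<^bsub>G\<^esub> t \<otimes>\<^bsub>G\<^esub> s)) h h"
  unfolding kernel_form_def opmat_form_def by (subst sum.swap) (simp add: inner_eq_Re_cinner)

lemma kernel_form_support:
  assumes "group G" and S: "finite S" "S \<subseteq> carrier G" and h: "\<And>s. s \<in> carrier G - S \<Longrightarrow> h s = 0"
    and T: "\<And>s. s \<in> carrier G \<Longrightarrow> bounded_clinear (T s)"
  shows "kernel_form G T {s \<in> carrier G. h s \<noteq> 0} h = kernel_form G T S h"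
proof -
  interpret group G by fact
  have sub: "{s \<in> carrier G. h s \<noteq> 0} \<subseteq> S"
    using h by blast
  have zero: "T (inv\<^bsub>G\<^esub> t \<otimes>\<^bsub>G\<^esub> s) 0 = 0" if "s \<in> carrier G" "t \<in> carrier G" for s t
    using T[of "inv\<^bsub>G\<^esub> t \<otimes>\<^bsub>G\<^esub> s"] that
    by (simp add: bounded_clinear_bounded_linear bounded_linear.linear linear_0)
  show ?thesis
    unfolding kernel_form_def
  proof (rule sum.mono_neutral_cong_left[OF S(1) sub])
    show "\<forall>s\<in>S - {s \<in> carrier G. h s \<noteq> 0}.
        (\<Sum>t\<in>S. cinner (T (inv\<^bsub>G\<^esub> t \<otimes>\<^bsub>G\<^esub> s) (h s)) (h t)) = 0"
      using zero subsetD[OF S(2)] by (intro ballI sum.neutral) auto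
    show "(\<Sum>t\<in>{t \<in> carrier G. h t \<noteq> 0}. cinner (T (inv\<^bsub>G\<^esub> t \<otimes>\<^bsub>G\<^esub> s) (h s)) (h t)) =
        (\<Sum>t\<in>S. cinner (T (inv\<^bsub>G\<^esub> t \<otimes>\<^bsub>G\<^esub> s) (h s)) (h t))" for s
      using S sub by (intro sum.mono_neutral_left) auto
  qed
qed

lemma positive_definite_kernel_form:
  assumes "group G" and T: "positive_definite G T" and S: "finite S" "S \<subseteq> carrier G"
  shows "kernel_form G T S h \<in> \<real>\<^sub>\<ge>\<^sub>0"
proof -
  \<comment> \<open>Cutting \<open>h\<close> off outside \<open>S\<close> makes the support finite
    and contained in \<open>S\<close>, without changing the sum over \<open>S\<close>.\<close>
  define h' where "h' = (\<lambda>s. if s \<in> S then h s else 0)"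
  have "finite {s \<in> carrier G. h' s \<noteq> 0}"
    by (rule finite_subset[OF _ S(1)]) (auto simp: h'_def split: if_splits)
  then have "kernel_form G T {s \<in> carrier G. h' s \<noteq> 0} h' \<in> \<real>\<^sub>\<ge>\<^sub>0"
    using T unfolding positive_definite_def kernel_form_def by blast
  moreover have "kernel_form G T {s \<in> carrier G. h' s \<noteq> 0} h' = kernel_form G T S h'"
    using assms by (intro kernel_form_support) (auto simp: h'_def positive_definite_def)
  moreover have "kernel_form G T S h' = kernel_form G T S h"
    by (simp add: kernel_form_def h'_def cong: sum.cong)
  ultimately show ?thesis
    by simp
qed

text \<open>
  The adjoint relation is recovered from the reality of the form: \<open>cadjoint\<close> is a description
  operator, so unfolding it would require the Riesz representation theorem.
\<close>

lemma positive_definite_adjoint: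
  assumes G: "group G" and T: "positive_definite G T" and s: "s \<in> carrier G"
  shows "cinner (T s x) y = cinner x (T (inv\<^bsub>G\<^esub> s) y)"
proof -
  interpret group G by fact
  have bcl: "bounded_clinear (T t)" if "t \<in> carrier G" for t
    using T that by (simp add: positive_definite_def)
  have lin: "T t (u + v) = T t u + T t v" "T t (a *\<^sub>C v) = a *\<^sub>C T t v"
    if "t \<in> carrier G" for t u v a
    using bcl[OF that] linear_add[OF bounded_linear.linear] by (auto simp: bounded_clinear_def)
  have one: "Im (cinner (T \<one>\<^bsub>G\<^esub> v) v) = 0" for v
    using positive_definite_kernel_form[OF G T, of "{\<one>\<^bsub>G\<^esub>}" "\<lambda>_. v"]
    by (simp add: kernel_form_def complex_nonneg_Reals_iff)
  \<comment> \<open>Polarization: placing x at \<open>s\<close> and y at the identity gives two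
    diagonal terms, real by \<open>one\<close>, and exactly these two mixed terms. If
    \<open>s\<close> is the identity, the two points coincide and x + y at that point is used
    instead.\<close>
  have real: "Im (cinner (T s x) y + cinner (T (inv\<^bsub>G\<^esub> s) y) x) = 0" for x y
  proof (cases "s = \<one>\<^bsub>G\<^esub>")
    case True
    then show ?thesis
      using one[of "x + y"] one[of x] one[of y]
      by (simp add: lin cinner_add_left cinner_add_right)
  next
    case False
    then show ?thesis
      using positive_definite_kernel_form[OF G T, of "{s, \<one>\<^bsub>G\<^esub>}" "\<lambda>t. if t = s then x else y"]
        s one[of x] one[of y]
      by (auto simp: kernel_form_def complex_nonneg_Reals_iff)
  qed
  have "Im (cinner (T s x) y) = - Im (cinner (T (inv\<^bsub>G\<^esub> s) y) x)"
    using real[of x y] by simp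
  \<comment> \<open>Multiplying x by the imaginary unit turns the statement on imaginary parts into
    one on real parts; conjugate linearity in the second argument supplies the minus sign.\<close>
  moreover have "Re (cinner (T s x) y) = Re (cinner (T (inv\<^bsub>G\<^esub> s) y) x)"
    using real[of "\<i> *\<^sub>C x" y] s
    by (simp add: lin cinner_scaleC_left cinner_scaleC_right)
  ultimately have "cinner (T s x) y = cnj (cinner (T (inv\<^bsub>G\<^esub> s) y) x)"
    by (simp add: complex_eq_iff)
  then show ?thesis
    by (metis cinner_commute)
qed

text \<open>Conjugation together with the adjoint relation exchanges \<open>s\<close> and
  \<open>t\<close> in the double sum, so the sum is real. What remains is nonnegativity of its real
  part, a statement about real forms.\<close>

lemma positive_definiteI:
  assumes G: "group G"
    and bcl: "\<And>s. s \<in> carrier G \<Longrightarrow> bounded_clinear (T s)"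
    and adj: "\<And>s x y. s \<in> carrier G \<Longrightarrow> cinner (T s x) y = cinner x (T (inv\<^bsub>G\<^esub> s) y)"
    and nonneg: "\<And>S h. finite S \<Longrightarrow> S \<subseteq> carrier G \<Longrightarrow>
      0 \<le> opmat_form S (\<lambda>t s. T (inv\<^bsub>G\<^esub> t \<otimes>\<^bsub>G\<^esub> s)) h h"
  shows "positive_definite G T"
  unfolding positive_definite_def
proof (intro conjI ballI allI impI)
  interpret group G by fact
  show "bounded_clinear (T s)" if "s \<in> carrier G" for s
    by (rule bcl[OF that])
  show "T (inv\<^bsub>G\<^esub> s) = cadjoint (T s)" if "s \<in> carrier G" for s
    by (rule cadjoint_eqI[symmetric]) (use that bcl adj in auto)
  fix h :: "'a \<Rightarrow> 'c"
  let ?S = "{s \<in> carrier G. h s \<noteq> 0}"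
  assume fin: "finite ?S"
  have "cnj (kernel_form G T ?S h) = kernel_form G T ?S h"
  proof -
    have "cnj (cinner (T (inv\<^bsub>G\<^esub> t \<otimes>\<^bsub>G\<^esub> s) (h s)) (h t)) =
        cinner (T (inv\<^bsub>G\<^esub> s \<otimes>\<^bsub>G\<^esub> t) (h t)) (h s)"
      if "s \<in> carrier G" "t \<in> carrier G" for s t
      using that adj[of "inv\<^bsub>G\<^esub> t \<otimes>\<^bsub>G\<^esub> s" "h s" "h t"]
      by (simp add: inv_mult_group cinner_commute[of "h s"])
    then have "cnj (kernel_form G T ?S h) =
        (\<Sum>s\<in>?S. \<Sum>t\<in>?S. cinner (T (inv\<^bsub>G\<^esub> s \<otimes>\<^bsub>G\<^esub> t) (h t)) (h s))"
      by (simp add: kernel_form_def)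
    then show ?thesis
      unfolding kernel_form_def by (subst sum.swap)
  qed
  then have "Im (kernel_form G T ?S h) = 0"
    by (simp add: complex_eq_iff)
  moreover have "0 \<le> Re (kernel_form G T ?S h)"
    unfolding Re_kernel_form by (rule nonneg[OF fin]) auto
  ultimately show "(\<Sum>s\<in>?S. \<Sum>t\<in>?S. cinner (T (inv\<^bsub>G\<^esub> t \<otimes>\<^bsub>G\<^esub> s) (h s)) (h t)) \<in> \<real>\<^sub>\<ge>\<^sub>0"
    by (simp add: kernel_form_def complex_nonneg_Reals_iff)
qed

section \<open>Powers of a commuting positive definite function\<close>

theorem theorem6p8:
  fixes G :: "('g, 'b) monoid_scheme"
    and N :: "'g \<Rightarrow> 'h::complex_hilbert_space \<Rightarrow> 'h"
    and k :: nat
  assumes "group G"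
    and "positive_definite G N"
    and "\<forall>s\<in>carrier G. normal_operator (N s)"
    and "\<forall>s\<in>carrier G. \<forall>t\<in>carrier G. N s \<circ> N t = N t \<circ> N s"
  shows "positive_definite G (\<lambda>s. N s ^^ k)"
proof -
  interpret group G by fact
  have bcl: "bounded_clinear (N s)" if "s \<in> carrier G" for s
    using assms(2) that by (simp add: positive_definite_def)
  note adj = positive_definite_adjoint[OF assms(1,2)]
  have comm: "N s ((N t ^^ m) v) = (N t ^^ m) (N s v)"
    if "s \<in> carrier G" "t \<in> carrier G" for s t m v
    using assms(4) that by (induction m) (auto simp: fun_eq_iff)
  show ?thesis
  proof (rule positive_definiteI[OF assms(1)])
    show "bounded_clinear (N s ^^ k)" if "s \<in> carrier G" for s
      by (intro bounded_clinear_funpow bcl that)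
    show "cinner ((N s ^^ k) x) y = cinner x ((N (inv\<^bsub>G\<^esub> s) ^^ k) y)"
      if "s \<in> carrier G" for s x y
      by (intro funpow_adjoint adj that)
    fix S h assume S: "finite S" "S \<subseteq> carrier G"
    have mem: "inv\<^bsub>G\<^esub> t \<otimes>\<^bsub>G\<^esub> s \<in> carrier G" if "s \<in> S" "t \<in> S" for s t
      using S that by blast
    \<comment> \<open>The vector \<open>h\<close> is generalized because the induction hypothesis
      serves as positivity of the second Schur factor, which is required at all vectors.\<close>
    show "0 \<le> opmat_form S (\<lambda>t s. N (inv\<^bsub>G\<^esub> t \<otimes>\<^bsub>G\<^esub> s) ^^ k) h h"
    proof (induction k arbitrary: h)
      case 0
      \<comment> \<open>Every entry is the identity, so the form is the squared norm of the sum of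
        the \<open>h s\<close>.\<close>
      have "opmat_form S (\<lambda>t s. N (inv\<^bsub>G\<^esub> t \<otimes>\<^bsub>G\<^esub> s) ^^ 0) h h = (\<Sum>s\<in>S. h s) \<bullet> (\<Sum>s\<in>S. h s)"
        by (simp add: opmat_form_def inner_sum_left inner_sum_right)
      then show ?case
        by (metis inner_ge_zero)
    next
      case (Suc k)
      \<comment> \<open>The matrix of powers with exponent \<open>Suc k\<close> is the Schur product
        of the kernel matrix of \<open>N\<close> with its entrywise power of exponent
        \<open>k\<close>.\<close>
      have "0 \<le> opmat_form S (\<lambda>t s v. N (inv\<^bsub>G\<^esub> t \<otimes>\<^bsub>G\<^esub> s) ((N (inv\<^bsub>G\<^esub> t \<otimes>\<^bsub>G\<^esub> s) ^^ k) v)) h h"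
      proof (rule opmat_schur_nonneg[OF S(1) _ _ _ Suc])
        show "bounded_linear (N (inv\<^bsub>G\<^esub> t \<otimes>\<^bsub>G\<^esub> s))" if "t \<in> S" "s \<in> S" for t s
          using that by (intro bounded_clinear_bounded_linear bcl mem)
        show "N (inv\<^bsub>G\<^esub> t \<otimes>\<^bsub>G\<^esub> s) v \<bullet> w = v \<bullet> N (inv\<^bsub>G\<^esub> s \<otimes>\<^bsub>G\<^esub> t) w"
          if "t \<in> S" "s \<in> S" for t s v w
        proof -
          \<comment> \<open>Inverting the group element swaps row and column, so the adjoint
            relation of \<open>N\<close> becomes symmetry of the kernel matrix.\<close>
          have "inv\<^bsub>G\<^esub> (inv\<^bsub>G\<^esub> t \<otimes>\<^bsub>G\<^esub> s) = inv\<^bsub>G\<^esub> s \<otimes>\<^bsub>G\<^esub> t"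
            using S that by (simp add: inv_mult_group subset_iff)
          then show ?thesis
            using adj[OF mem, of s t v w] that by (simp add: inner_eq_Re_cinner)
        qed
        show "0 \<le> opmat_form S (\<lambda>t s. N (inv\<^bsub>G\<^esub> t \<otimes>\<^bsub>G\<^esub> s)) y y" for y
          using positive_definite_kernel_form[OF assms(1,2) S, of y]
          by (simp add: Re_kernel_form[symmetric] complex_nonneg_Reals_iff)
        show "linear (N (inv\<^bsub>G\<^esub> t \<otimes>\<^bsub>G\<^esub> s) ^^ k)" if "t \<in> S" "s \<in> S" for t s
          using that by (intro bounded_linear.linear bounded_clinear_bounded_linear
              bounded_clinear_funpow bcl mem)
      qed (intro comm mem)
      then show ?case
        by (simp add: o_def)
    qed
  qed
qed

end
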